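(* Let $K\subset\mathbb{R}^n$ be a self-dual cone and let $f\in\mathbb{R}[x_1,\dots,x_n]$ be a $K$-Lorentzian form of degree $d$. Then for any $a\in K$ such that the Hessian matrix $A=H_f(a)$ is nonsingular, $A$ satisfies the generalized Perron--Frobenius property with respect to $K$; that is, writing $\rho$ for the spectral radius of $A$: (1) $\rho$ is a simple positive eigenvalue of $A$; (2) there exists a (unique up to a scalar multiple) eigenvector $u\in\operatorname{int}K$ of $A$ corresponding to $\rho$; (3) $u$ is, up to positive scalar multiples, the only eigenvector of $A$ (for any eigenvalue) lying in $K\setminus\{0\}$; (4) $K\cap(\rho I-A)\mathbb{R}^n=\{0\}$.
   Context: A cone $K\subset\mathbb{R}^n$ is self-dual if $K=K^*=\{y:\langle y,x\rangle\ge0\ \forall x\in K\}$ (standard inner product); such a cone is a proper convex cone, i.e. closed, convex, pointed, with nonempty interior $\operatorname{int}K$. For $a\in\mathbb{R}^n$, $D_af=\sum_i a_i\,\partial f/\partial x_i$. A form $f$ of degree $d\ge2$ is $K$-Lorentzian if for any $a_1,\dots,a_{d-2}\in\operatorname{int}K$ the quadratic form $q=D_{a_1}\cdots D_{a_{d-2}}f$, written $q(x)=x^tQx$ with $Q$ symmetric, satisfies: (1) $Q$ has exactly one positive eigenvalue; (2) $y^tQx>0$ for all $x,y\in\operatorname{int}K$. For degree $d\le1$ a form is $K$-Lorentzian if it is nonnegative on $K$. *)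

theory Defs
  imports "HOL-Analysis.Analysis" "HOL-Computational_Algebra.Polynomial"
begin

definition dual_cone :: "(real^'n) set \<Rightarrow> (real^'n) set" where
  "dual_cone K = {y. \<forall>x\<in>K. 0 \<le> y \<bullet> x}"

definition self_dual_cone :: "(real^'n) set \<Rightarrow> bool" where
  "self_dual_cone K \<longleftrightarrow> cone K \<and> K = dual_cone K"


text \<open>Polynomials over the infinite field of real numbers are identified with the functions they
  induce. A form of degree \<open>d\<close> is a linear combination of the monomials \<open>x\<^sup>\<alpha>\<close>, where \<open>\<alpha>\<close> ranges over
  the (finitely many) multi-indices of total degree \<open>d\<close>. The zero form has every degree.\<close>

definition form_of_degree :: "nat \<Rightarrow> (real^'n \<Rightarrow> real) \<Rightarrow> bool" where
  "form_of_degree d f \<longleftrightarrow>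
     (\<exists>c :: ('n \<Rightarrow> nat) \<Rightarrow> real.
        \<forall>x. f x = (\<Sum>\<alpha> | (\<Sum>i\<in>UNIV. \<alpha> i) = d. c \<alpha> * (\<Prod>i\<in>UNIV. (x $ i) ^ \<alpha> i)))"

lemma finite_multi_indices: "finite {\<alpha> :: 'n::finite \<Rightarrow> nat. (\<Sum>i\<in>UNIV. \<alpha> i) = d}"
proof (rule finite_subset)
  show "{\<alpha> :: 'n \<Rightarrow> nat. (\<Sum>i\<in>UNIV. \<alpha> i) = d} \<subseteq> (\<Pi>\<^sub>E i\<in>UNIV. {..d})"
    by (auto simp: PiE_UNIV_domain intro: member_le_sum)
qed (intro finite_PiE; simp)

definition partial_deriv :: "'n \<Rightarrow> (real^'n \<Rightarrow> real) \<Rightarrow> real^'n \<Rightarrow> real" where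
  "partial_deriv i f x = deriv (\<lambda>t. f (x + t *\<^sub>R axis i 1)) 0"

definition dir_deriv :: "real^'n \<Rightarrow> (real^'n \<Rightarrow> real) \<Rightarrow> real^'n \<Rightarrow> real" where
  "dir_deriv a f x = (\<Sum>i\<in>UNIV. a $ i * partial_deriv i f x)"

definition hessian :: "(real^'n \<Rightarrow> real) \<Rightarrow> real^'n \<Rightarrow> real^'n^'n" where
  "hessian f x = (\<chi> i j. partial_deriv i (partial_deriv j f) x)"

definition eigenvector :: "'a::field^'n^'n \<Rightarrow> 'a^'n \<Rightarrow> 'a \<Rightarrow> bool" where
  "eigenvector A v \<mu> \<longleftrightarrow> v \<noteq> 0 \<and> A *v v = \<mu> *s v"

definition eigenvalue :: "'a::field^'n^'n \<Rightarrow> 'a \<Rightarrow> bool" where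
  "eigenvalue A \<mu> \<longleftrightarrow> (\<exists>v. eigenvector A v \<mu>)"

definition charpoly :: "'a::field^'n^'n \<Rightarrow> 'a poly" where
  "charpoly A = det (\<chi> i j. (if i = j then [:0, 1:] else 0) - [:A $ i $ j:])"

definition alg_multiplicity :: "'a::field^'n^'n \<Rightarrow> 'a \<Rightarrow> nat" where
  "alg_multiplicity A \<mu> = order \<mu> (charpoly A)"

definition simple_eigenvalue :: "'a::field^'n^'n \<Rightarrow> 'a \<Rightarrow> bool" where
  "simple_eigenvalue A \<mu> \<longleftrightarrow> eigenvalue A \<mu> \<and> alg_multiplicity A \<mu> = 1"

text \<open>The maximum is over the complex eigenvalues of the real matrix \<open>A\<close>.\<close>

definition spectral_radius :: "real^'n^'n \<Rightarrow> real" where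
  "spectral_radius A =
     Max {cmod \<mu> |\<mu>. eigenvalue (\<chi> i j. complex_of_real (A $ i $ j)) \<mu>}"

text \<open>Eigenvalues are counted with multiplicity.\<close>

definition exactly_one_positive_eigenvalue :: "real^'n^'n \<Rightarrow> bool" where
  "exactly_one_positive_eigenvalue Q \<longleftrightarrow>
     (\<Sum>\<mu> | 0 < \<mu> \<and> eigenvalue Q \<mu>. alg_multiplicity Q \<mu>) = 1"

text \<open>In degree at least two, \<open>as\<close> is the list of the directions \<open>a\<^sub>1, \<dots>, a\<^bsub>d-2\<^esub>\<close>, and the matrix
  \<open>Q\<close> is uniquely determined by the quadratic form it represents.\<close>

definition K_Lorentzian :: "(real^'n) set \<Rightarrow> nat \<Rightarrow> (real^'n \<Rightarrow> real) \<Rightarrow> bool" where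
  "K_Lorentzian K d f \<longleftrightarrow>
     form_of_degree d f \<and>
     (if d \<le> 1 then \<forall>x\<in>K. 0 \<le> f x
      else \<forall>as. length as = d - 2 \<and> set as \<subseteq> interior K \<longrightarrow>
             (\<exists>Q. transpose Q = Q \<and>
                  (\<forall>x. foldr dir_deriv as f x = x \<bullet> (Q *v x)) \<and>
                  exactly_one_positive_eigenvalue Q \<and>
                  (\<forall>x\<in>interior K. \<forall>y\<in>interior K. 0 < y \<bullet> (Q *v x))))"

end

theory Submission
  imports Defs
begin

text \<open>
  For \<open>a\<close> in the interior of the self-dual cone \<open>K\<close>, the Hessian of a \<open>K\<close>-Lorentzian form \<open>f\<close> of degree
  \<open>d \<ge> 2\<close> is a positive multiple of the matrix \<open>Q\<close> obtained from \<open>d - 2\<close> derivatives of \<open>f\<close> in the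
  direction \<open>a\<close>, by Euler's identity (\<open>hessian_eq_polarized_quadratic_form\<close>). So the Hessian maps
  \<open>K\<close> into its dual \<open>K\<close>, and having a single positive eigenvalue it satisfies the reverse
  Cauchy--Schwarz inequality on \<open>K\<close> (\<open>reverse_cauchy_schwarz\<close>). Both properties are closed
  conditions and therefore hold for all \<open>a\<close> in \<open>K\<close> (\<open>hessian_lorentzian_cone\<close>). In degree at most one
  the Hessian vanishes and cannot be nonsingular.

  It remains to consider a nonsingular symmetric matrix \<open>A\<close> with these two properties. Splitting a
  vector into orthogonal parts \<open>p - q\<close> with \<open>p\<close> and \<open>q\<close> in \<open>K\<close> shows that \<open>\<bar>x \<bullet> A x\<bar>\<close> attains its maximum
  over the unit sphere at a vector \<open>u\<close> of \<open>K\<close>; this is an eigenvector for the spectral radius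
  (\<open>cone_preserving_symmetric_top_eigenvector\<close>, \<open>spectral_radius_symmetric\<close>). The reverse
  Cauchy--Schwarz inequality together with nonsingularity makes the form of \<open>A\<close> negative definite on
  the orthogonal complement of \<open>u\<close>, whereas it is nonnegative on \<open>K\<close>. Hence \<open>u\<close> is strictly positive
  on \<open>K - {0}\<close>, and all assertions follow by orthogonality
  (\<open>lorentzian_matrix_perron_frobenius\<close>).

  The spectral theorem for real symmetric matrices is used to translate algebraic multiplicities,
  which are orders of roots of the characteristic polynomial, into statements about eigenvectors.
\<close>

section \<open>Directional derivatives of homogeneous polynomials\<close>

text \<open>The partial derivatives are defined as one-dimensional limits. For polynomial functions they are
read off the total derivative \<open>F\<close>, which gives all calculation rules at once.\<close>

lemma partial_deriv_has_derivative:
  assumes "(f has_derivative F) (at x)"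
  shows "partial_deriv i f x = F (axis i 1)"
proof -
  have F: "linear F" using assms has_derivative_linear by blast
  have "((\<lambda>t. f (x + t *\<^sub>R axis i 1)) has_derivative (\<lambda>t. F (t *\<^sub>R axis i 1))) (at 0)"
    by (rule has_derivative_compose[where g = f])
       (auto intro!: derivative_eq_intros simp: assms)
  then have "((\<lambda>t. f (x + t *\<^sub>R axis i 1)) has_field_derivative F (axis i 1)) (at 0)"
    unfolding has_field_derivative_def using linear_cmul[OF F] by (simp add: mult_commute_abs)
  then show ?thesis unfolding partial_deriv_def by (rule DERIV_imp_deriv)
qed

lemma dir_deriv_has_derivative:
  assumes "(f has_derivative F) (at x)"
  shows "dir_deriv a f x = F a"
proof -
  have F: "linear F" using assms has_derivative_linear by blast
  have "F a = F (\<Sum>i\<in>UNIV. a $ i *\<^sub>R axis i 1)"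
    using basis_expansion[of a] by (simp add: scalar_mult_eq_scaleR)
  also have "\<dots> = dir_deriv a f x"
    unfolding dir_deriv_def partial_deriv_has_derivative[OF assms]
    by (simp add: linear_sum[OF F] linear_cmul[OF F])
  finally show ?thesis by simp
qed

lemma partial_deriv_eq_dir_deriv: "partial_deriv i f = dir_deriv (axis i 1) f"
proof
  fix x
  have "dir_deriv (axis i 1) f x = (\<Sum>j\<in>UNIV. if j = i then partial_deriv j f x else 0)"
    unfolding dir_deriv_def by (rule sum.cong) (auto simp: axis_def)
  then show "partial_deriv i f x = dir_deriv (axis i 1) f x" by simp
qed

lemma polynomial_has_derivative:
  assumes "real_polynomial_function (f :: real^'n \<Rightarrow> real)"
  obtains F where "(f has_derivative F) (at x)"
  using differentiable_at_real_polynomial_function[OF assms, of x UNIV]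
  by (auto simp: differentiable_def)

lemma dir_deriv_const: "dir_deriv a (\<lambda>_. c) = (\<lambda>_. 0)"
  by (rule ext, subst dir_deriv_has_derivative[OF has_derivative_const]) simp

lemma dir_deriv_bounded_linear: "bounded_linear h \<Longrightarrow> dir_deriv a h = (\<lambda>_. h a)"
  by (rule ext, rule dir_deriv_has_derivative) (rule bounded_linear_imp_has_derivative)

lemma dir_deriv_add:
  assumes "real_polynomial_function f" "real_polynomial_function g"
  shows "dir_deriv a (\<lambda>x. f x + g x) = (\<lambda>x. dir_deriv a f x + dir_deriv a g x)"
proof
  fix x
  obtain F G where "(f has_derivative F) (at x)" "(g has_derivative G) (at x)"
    using assms polynomial_has_derivative by metis
  then show "dir_deriv a (\<lambda>x. f x + g x) x = dir_deriv a f x + dir_deriv a g x"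
    by (simp add: dir_deriv_has_derivative dir_deriv_has_derivative[OF has_derivative_add])
qed

lemma dir_deriv_mult:
  assumes "real_polynomial_function f" "real_polynomial_function g"
  shows "dir_deriv a (\<lambda>x. f x * g x) = (\<lambda>x. f x * dir_deriv a g x + dir_deriv a f x * g x)"
proof
  fix x
  obtain F G where "(f has_derivative F) (at x)" "(g has_derivative G) (at x)"
    using assms polynomial_has_derivative by metis
  then show "dir_deriv a (\<lambda>x. f x * g x) x = f x * dir_deriv a g x + dir_deriv a f x * g x"
    by (simp add: dir_deriv_has_derivative dir_deriv_has_derivative[OF has_derivative_mult])
qed

lemma polynomial_dir_deriv:
  assumes "real_polynomial_function f"
  shows "real_polynomial_function (dir_deriv a f)"
  using assms
proof induction
  case (add f g)
  then show ?case by (simp add: dir_deriv_add real_polynomial_function.intros)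
next
  case (mult f g)
  then show ?case by (simp add: dir_deriv_mult real_polynomial_function.intros)
qed (simp_all add: dir_deriv_bounded_linear dir_deriv_const real_polynomial_function.intros(2))

text \<open>Both sides obey the same sum and product rules and vanish on linear functions, so the claim
follows by induction over the construction of the polynomial function.\<close>

lemma dir_deriv_commute:
  assumes "real_polynomial_function f"
  shows "dir_deriv a (dir_deriv b f) = dir_deriv b (dir_deriv a f)"
  using assms
proof induction
  case (add f g)
  then show ?case by (simp add: dir_deriv_add polynomial_dir_deriv)
next
  case (mult f g)
  then show ?case
    by (simp add: dir_deriv_add dir_deriv_mult polynomial_dir_deriv real_polynomial_function.intros(4)
        algebra_simps)
qed (simp_all add: dir_deriv_bounded_linear dir_deriv_const)

lemma polynomial_funpow_dir_deriv:
  "real_polynomial_function f \<Longrightarrow> real_polynomial_function ((dir_deriv a ^^ k) f)"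
  by (induction k) (auto intro: polynomial_dir_deriv)

lemma funpow_dir_deriv_commute:
  assumes "real_polynomial_function f"
  shows "dir_deriv b ((dir_deriv a ^^ k) f) = (dir_deriv a ^^ k) (dir_deriv b f)"
proof (induction k)
  case (Suc k)
  have "dir_deriv b ((dir_deriv a ^^ Suc k) f) = dir_deriv a (dir_deriv b ((dir_deriv a ^^ k) f))"
    using dir_deriv_commute[OF polynomial_funpow_dir_deriv[OF assms]] by simp
  then show ?case using Suc by simp
qed simp

text \<open>Only positive factors occur, because passing to a derivative cancels one factor \<open>t\<close>.\<close>

definition pos_homogeneous :: "nat \<Rightarrow> (real^'n \<Rightarrow> real) \<Rightarrow> bool" where
  "pos_homogeneous k f \<longleftrightarrow> (\<forall>t>0. \<forall>x. f (t *\<^sub>R x) = t ^ k * f x)"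

lemma form_polynomial:
  fixes f :: "real^'n \<Rightarrow> real"
  assumes "form_of_degree d f"
  shows "real_polynomial_function f"
proof -
  from assms[unfolded form_of_degree_def] obtain c where
    c: "\<forall>x. f x = (\<Sum>\<alpha> | (\<Sum>i\<in>UNIV. \<alpha> i) = d. c \<alpha> * (\<Prod>i\<in>UNIV. (x $ i) ^ \<alpha> i))" ..
  have "f = (\<lambda>x. \<Sum>\<alpha> | (\<Sum>i\<in>UNIV. \<alpha> i) = d. c \<alpha> * (\<Prod>i\<in>UNIV. (x $ i) ^ \<alpha> i))"
    by (rule ext) (rule c[rule_format])
  moreover have "real_polynomial_function (\<lambda>x :: real^'n. x $ i)" for i
    by (intro real_polynomial_function.intros(1) bounded_linear_vec_nth)
  ultimately show ?thesis
    by (simp only:) (intro real_polynomial_function_sum real_polynomial_function.intros(4)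
        real_polynomial_function.intros(2) real_polynomial_function_prod
        real_polynomial_function_power finite_multi_indices finite)
qed

lemma form_pos_homogeneous:
  assumes "form_of_degree d f"
  shows "pos_homogeneous d f"
proof -
  from assms[unfolded form_of_degree_def] obtain c where
    c: "\<forall>x. f x = (\<Sum>\<alpha> | (\<Sum>i\<in>UNIV. \<alpha> i) = d. c \<alpha> * (\<Prod>i\<in>UNIV. (x $ i) ^ \<alpha> i))" ..
  show ?thesis
    unfolding pos_homogeneous_def c[rule_format] sum_distrib_left
    by (intro allI impI sum.cong)
       (auto simp: power_mult_distrib prod.distrib power_sum[symmetric] mult.left_commute)
qed

lemma pos_homogeneous_dir_deriv:
  assumes f: "real_polynomial_function f" and "pos_homogeneous (Suc k) f"
  shows "pos_homogeneous k (dir_deriv a f)"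
  unfolding pos_homogeneous_def
proof (intro allI impI)
  fix t :: real and x assume t: "0 < t"
  obtain F F' where F: "(f has_derivative F) (at (t *\<^sub>R x))" and F': "(f has_derivative F') (at x)"
    using f polynomial_has_derivative by metis
  have 1: "((\<lambda>y. f (t *\<^sub>R y)) has_derivative (\<lambda>h. F (t *\<^sub>R h))) (at x)"
    by (rule has_derivative_compose[where g = f]) (auto intro!: derivative_eq_intros simp: F)
  have "((\<lambda>y. t ^ Suc k * f y) has_derivative (\<lambda>h. t ^ Suc k * F' h)) (at x)"
    by (intro has_derivative_mult_right F')
  moreover have "(\<lambda>y. f (t *\<^sub>R y)) = (\<lambda>y. t ^ Suc k * f y)"
    using assms(2) t by (auto simp: pos_homogeneous_def)
  ultimately have "F (t *\<^sub>R a) = t ^ Suc k * F' a"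
    using has_derivative_unique[OF 1] by metis
  moreover have "F (t *\<^sub>R a) = t * F a"
    using linear_cmul[OF has_derivative_linear[OF F]] by simp
  ultimately show "dir_deriv a f (t *\<^sub>R x) = t ^ k * dir_deriv a f x"
    using t by (simp add: dir_deriv_has_derivative[OF F] dir_deriv_has_derivative[OF F'])
qed

lemma euler_identity:
  assumes f: "real_polynomial_function f" and hom: "pos_homogeneous k f"
  shows "dir_deriv x f x = real k * f x"
proof -
  obtain F where F: "(f has_derivative F) (at x)"
    using f polynomial_has_derivative by metis
  have "((\<lambda>t. f (t *\<^sub>R x)) has_derivative (\<lambda>s. F (s *\<^sub>R x))) (at 1)"
    by (rule has_derivative_compose[where g = f]) (auto intro!: derivative_eq_intros simp: F)
  then have 1: "((\<lambda>t. f (t *\<^sub>R x)) has_field_derivative F x) (at 1)"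
    unfolding has_field_derivative_def using linear_cmul[OF has_derivative_linear[OF F]]
    by (simp add: mult_commute_abs)
  have "((\<lambda>t. t ^ k * f x) has_field_derivative real k * f x) (at 1)"
    by (auto intro!: derivative_eq_intros)
  then have "((\<lambda>t. f (t *\<^sub>R x)) has_field_derivative real k * f x) (at 1)"
    by (rule has_field_derivative_transform_within_open[where S = "{0<..}"])
       (use hom in \<open>auto simp: pos_homogeneous_def\<close>)
  then show ?thesis
    using DERIV_unique[OF 1] dir_deriv_has_derivative[OF F] by simp
qed

text \<open>Euler's identity is applied \<open>k\<close> times, each derivative having one degree less. Thus the iterated
derivative along \<open>a\<close>, evaluated at \<open>a\<close> itself, recovers the value of the form; this is what links
the derivatives in the definition of a Lorentzian form with the Hessian at \<open>a\<close>.\<close>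

lemma funpow_dir_deriv_base_point:
  assumes "real_polynomial_function g" and "pos_homogeneous k g"
  shows "(dir_deriv a ^^ k) g a = fact k * g a"
  using assms
proof (induction k arbitrary: g)
  case (Suc k)
  have "(dir_deriv a ^^ Suc k) g a = (dir_deriv a ^^ k) (dir_deriv a g) a"
    by (simp add: funpow_swap1)
  also have "\<dots> = fact k * dir_deriv a g a"
    by (rule Suc.IH[OF polynomial_dir_deriv pos_homogeneous_dir_deriv]) (rule Suc.prems)+
  also have "\<dots> = fact (Suc k) * g a"
    using euler_identity[OF Suc.prems] by (simp add: algebra_simps)
  finally show ?case .
qed simp

text \<open>Degree zero makes the function constant on each open ray from the origin, and the constant is the
value at the origin by continuity.\<close>

lemma pos_homogeneous_0_const:
  fixes f :: "real^'n \<Rightarrow> real"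
  assumes f: "real_polynomial_function f" and hom: "pos_homogeneous 0 f"
  shows "f = (\<lambda>_. f 0)"
proof
  fix x :: "real^'n"
  obtain F where "(f has_derivative F) (at 0)"
    using f polynomial_has_derivative by metis
  then have "isCont f 0" by (rule has_derivative_continuous)
  moreover have "((\<lambda>t. t *\<^sub>R x) \<longlongrightarrow> 0 *\<^sub>R x) (at_right (0::real))"
    by (intro tendsto_intros)
  ultimately have "((\<lambda>t. f (t *\<^sub>R x)) \<longlongrightarrow> f 0) (at_right (0::real))"
    using isCont_tendsto_compose[of 0 f "\<lambda>t. t *\<^sub>R x" "at_right 0"] by simp
  moreover have "((\<lambda>t. f (t *\<^sub>R x)) \<longlongrightarrow> f x) (at_right (0::real))"
    by (rule tendsto_eventually)
       (use hom in \<open>auto simp: pos_homogeneous_def eventually_at_right_less eventually_at_filter\<close>)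
  ultimately show "f x = f 0"
    using tendsto_unique[of "at_right (0::real)"] by auto
qed

lemma dir_deriv_quadratic_form:
  assumes "transpose Q = (Q :: real^'n^'n)"
  shows "dir_deriv b (dir_deriv c (\<lambda>x. x \<bullet> (Q *v x))) = (\<lambda>_. 2 * (b \<bullet> (Q *v c)))"
proof -
  have sym: "x \<bullet> (Q *v y) = y \<bullet> (Q *v x)" for x y
    by (metis assms dot_lmul_matrix inner_commute vector_transpose_matrix)
  have "dir_deriv c (\<lambda>x. x \<bullet> (Q *v x)) x = x \<bullet> (2 *\<^sub>R (Q *v c))" for x
  proof -
    have "((\<lambda>x. x \<bullet> (Q *v x)) has_derivative (\<lambda>h. x \<bullet> (Q *v h) + h \<bullet> (Q *v x))) (at x)"
      by (intro has_derivative_inner has_derivative_ident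
          bounded_linear_imp_has_derivative matrix_vector_mul_bounded_linear)
    from dir_deriv_has_derivative[OF this, of c] show ?thesis using sym[of c x] by simp
  qed
  then have "dir_deriv c (\<lambda>x. x \<bullet> (Q *v x)) = (\<lambda>x. x \<bullet> (2 *\<^sub>R (Q *v c)))" by (rule ext)
  moreover have "dir_deriv b \<dots> = (\<lambda>_. b \<bullet> (2 *\<^sub>R (Q *v c)))"
    by (rule dir_deriv_bounded_linear) (rule bounded_linear_inner_left)
  ultimately show ?thesis by simp
qed

section \<open>The Hessian of a form\<close>

lemma hessian_component: "hessian f x $ i $ j = dir_deriv (axis i 1) (dir_deriv (axis j 1) f) x"
  by (simp add: hessian_def partial_deriv_eq_dir_deriv)

lemma hessian_symmetric:
  assumes "real_polynomial_function f"
  shows "transpose (hessian f x) = hessian f x"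
  using dir_deriv_commute[OF assms] by (simp add: vec_eq_iff transpose_def hessian_component)

lemma hessian_degree_le_1:
  assumes f: "form_of_degree d f" and "d \<le> 1"
  shows "hessian f x = 0"
proof -
  have p: "real_polynomial_function f" and h: "pos_homogeneous d f"
    using f form_polynomial form_pos_homogeneous by auto
  have "dir_deriv b (dir_deriv c f) = (\<lambda>_. 0)" for b c
  proof (cases "d = 0")
    case True
    then have "f = (\<lambda>_. f 0)" using pos_homogeneous_0_const p h by auto
    then have "dir_deriv c f = (\<lambda>_. 0)" using dir_deriv_const[of c "f 0"] by simp
    then show ?thesis by (simp add: dir_deriv_const)
  next
    case False
    then have "pos_homogeneous (Suc 0) f" using h assms(2) by (cases d) auto
    then have "pos_homogeneous 0 (dir_deriv c f)" by (rule pos_homogeneous_dir_deriv[OF p])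
    then have "dir_deriv c f = (\<lambda>_. dir_deriv c f 0)"
      by (intro pos_homogeneous_0_const polynomial_dir_deriv p)
    then show ?thesis using dir_deriv_const[of b "dir_deriv c f 0"] by simp
  qed
  then show ?thesis by (simp add: vec_eq_iff hessian_component)
qed

text \<open>In the definition of a Lorentzian form all directions may be taken equal to \<open>a\<close>. Since derivatives
commute, the second derivatives of \<open>D\<^sub>a\<^sup>k f\<close> with \<open>k = d - 2\<close>, which are the entries of \<open>2 Q\<close>, are the
\<open>k\<close>-th derivatives along \<open>a\<close> of the second derivatives of \<open>f\<close>. The latter are homogeneous of
degree \<open>k\<close>, so at \<open>a\<close> the result is \<open>k!\<close> times the Hessian.\<close>

lemma hessian_eq_polarized_quadratic_form:
  assumes f: "form_of_degree d f" and d: "2 \<le> d"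
    and sym: "transpose Q = Q"
    and Q: "\<And>x. foldr dir_deriv (replicate (d - 2) a) f x = x \<bullet> (Q *v x)"
  shows "hessian f a = (2 / fact (d - 2)) *\<^sub>R Q"
proof -
  define k where "k = d - 2"
  have dk: "d = Suc (Suc k)" using d k_def by simp
  have p: "real_polynomial_function f" and h: "pos_homogeneous (Suc (Suc k)) f"
    using f form_polynomial form_pos_homogeneous dk by auto
  have Q': "(dir_deriv a ^^ k) f = (\<lambda>x. x \<bullet> (Q *v x))"
    using Q by (auto simp: foldr_replicate k_def)
  have "fact k * hessian f a $ i $ j = 2 * Q $ i $ j" for i j
  proof -
    let ?b = "axis i 1 :: real^'a" and ?c = "axis j 1 :: real^'a"
    have "fact k * dir_deriv ?b (dir_deriv ?c f) a
        = (dir_deriv a ^^ k) (dir_deriv ?b (dir_deriv ?c f)) a"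
      using funpow_dir_deriv_base_point p h polynomial_dir_deriv pos_homogeneous_dir_deriv by metis
    also have "\<dots> = dir_deriv ?b (dir_deriv ?c ((dir_deriv a ^^ k) f)) a"
      using funpow_dir_deriv_commute p polynomial_dir_deriv by metis
    also have "\<dots> = 2 * (?b \<bullet> (Q *v ?c))"
      unfolding Q' dir_deriv_quadratic_form[OF sym] ..
    also have "?b \<bullet> (Q *v ?c) = Q $ i $ j"
      by (simp add: inner_axis' matrix_vector_mul_component inner_axis)
    finally show ?thesis by (simp add: hessian_component)
  qed
  then show ?thesis
    by (simp add: vec_eq_iff k_def field_simps)
qed

lemma continuous_on_hessian_bilinear:
  assumes "real_polynomial_function f"
  shows "continuous_on S (\<lambda>a. e \<bullet> (hessian f a *v x))"
proof -
  have "continuous_on S (dir_deriv b (dir_deriv c f))" for b c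
    using assms continuous_on_polymonial_function[of "dir_deriv b (dir_deriv c f)" S]
    by (simp add: polynomial_dir_deriv flip: real_polynomial_function_eq)
  then have "continuous_on S (\<lambda>a. \<Sum>i\<in>UNIV. e $ i *
      (\<Sum>j\<in>UNIV. dir_deriv (axis i 1) (dir_deriv (axis j 1) f) a * x $ j))"
    by (intro continuous_intros)
  then show ?thesis
    by (simp add: inner_vec_def matrix_vector_mult_def hessian_component)
qed

section \<open>Spectral decomposition of real symmetric matrices\<close>

lemma symmetric_dot:
  fixes A :: "real^'n^'n"
  assumes "transpose A = A"
  shows "x \<bullet> (A *v y) = y \<bullet> (A *v x)"
  by (metis assms dot_lmul_matrix inner_commute vector_transpose_matrix)

text \<open>If \<open>w = C u\<close> were nonzero, moving from \<open>u\<close> a little in the direction \<open>- w\<close> would change the form by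
\<open>2 t \<bar>w\<bar>\<^sup>2\<close> to first order in \<open>t < 0\<close> and so make it negative.\<close>

lemma psd_form_isotropic_in_kernel:
  fixes C :: "real^'n^'n"
  assumes sym: "transpose C = C" and S: "subspace S"
    and inv: "\<And>x. x \<in> S \<Longrightarrow> C *v x \<in> S"
    and psd: "\<And>x. x \<in> S \<Longrightarrow> 0 \<le> x \<bullet> (C *v x)"
    and u: "u \<in> S" "u \<bullet> (C *v u) = 0"
  shows "C *v u = 0"
proof (rule ccontr)
  define w where "w = C *v u"
  define \<alpha> \<beta> where "\<alpha> = w \<bullet> w" and "\<beta> = w \<bullet> (C *v w)"
  assume "C *v u \<noteq> 0"
  then have \<alpha>: "0 < \<alpha>" by (simp add: \<alpha>_def w_def)
  have wS: "w \<in> S" using inv u w_def by simp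
  have \<beta>: "0 \<le> \<beta>" using psd[OF wS] \<beta>_def by simp
  \<comment> \<open>\<open>- \<alpha> / \<beta>\<close> would minimize the form on the line; the \<open>1\<close> avoids division by zero and still gives
      a negative value.\<close>
  define t where "t = - \<alpha> / (\<beta> + 1)"
  have "0 \<le> (u + t *\<^sub>R w) \<bullet> (C *v (u + t *\<^sub>R w))"
    by (intro psd subspace_add subspace_scale S u wS)
  also have "\<dots> = u \<bullet> (C *v u) + t * (w \<bullet> (C *v u)) + t * (u \<bullet> (C *v w)) + t^2 * (w \<bullet> (C *v w))"
    by (simp add: matrix_vector_right_distrib matrix_vector_mult_scaleR inner_add_left
        inner_add_right power2_eq_square algebra_simps)
  also have "\<dots> = 2 * t * \<alpha> + t\<^sup>2 * \<beta>"
    using u symmetric_dot[OF sym, of u w] by (simp add: \<alpha>_def \<beta>_def w_def[symmetric])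
  finally have "0 \<le> 2 * t * \<alpha> + t\<^sup>2 * \<beta>" .
  moreover have "(2 * t * \<alpha> + t\<^sup>2 * \<beta>) * (\<beta> + 1)\<^sup>2 = - (\<alpha>\<^sup>2 * (\<beta> + 2))"
  proof -
    have t: "t * (\<beta> + 1) = - \<alpha>" using \<beta> by (simp add: t_def)
    have "(2 * t * \<alpha> + t\<^sup>2 * \<beta>) * (\<beta> + 1)\<^sup>2
        = 2 * (t * (\<beta> + 1)) * \<alpha> * (\<beta> + 1) + (t * (\<beta> + 1))\<^sup>2 * \<beta>"
      by (simp add: power2_eq_square algebra_simps)
    also have "\<dots> = - (\<alpha>\<^sup>2 * (\<beta> + 2))"
      unfolding t by (simp add: power2_eq_square algebra_simps)
    finally show ?thesis .
  qed
  moreover have "0 < \<alpha>\<^sup>2 * (\<beta> + 2)" using \<alpha> \<beta> by simp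
  ultimately show False
    by (smt (verit) mult_nonneg_nonneg zero_le_power2)
qed

text \<open>A vector that attains the bound is isotropic for the positive semidefinite form of \<open>M I - A\<close>, hence
in the kernel of this matrix.\<close>

lemma maximal_quotient_eigenvector:
  fixes A :: "real^'n^'n"
  assumes sym: "transpose A = A" and S: "subspace S"
    and inv: "\<And>x. x \<in> S \<Longrightarrow> A *v x \<in> S"
    and max: "\<And>x. x \<in> S \<Longrightarrow> x \<bullet> (A *v x) \<le> M * (x \<bullet> x)"
    and u: "u \<in> S" "u \<bullet> (A *v u) = M * (u \<bullet> u)"
  shows "A *v u = M *\<^sub>R u"
proof -
  define C where "C = M *\<^sub>R mat 1 - A"
  have C: "C *v x = M *\<^sub>R x - A *v x" for x
    by (simp add: C_def matrix_vector_mult_diff_rdistrib flip: scaleR_matrix_vector_assoc)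
  have "transpose C = C"
    using sym by (auto simp: C_def vec_eq_iff transpose_def mat_def)
  then have "C *v u = 0"
    by (rule psd_form_isotropic_in_kernel[OF _ S])
       (auto simp: C inner_diff_right max u inv subspace_diff subspace_scale S)
  then show ?thesis by (simp add: C)
qed

text \<open>The set is only required to be closed under nonnegative scaling, so that the result serves both for
subspaces, in the spectral theorem, and for cones.\<close>

lemma quadratic_form_attains_max:
  fixes A :: "real^'n^'n"
  assumes "closed S" "S \<noteq> {0}" "S \<noteq> {}"
    and scale: "\<And>c x. x \<in> S \<Longrightarrow> 0 \<le> c \<Longrightarrow> c *\<^sub>R x \<in> S"
  obtains u where "u \<in> S" "norm u = 1"
    "\<And>x. x \<in> S \<Longrightarrow> x \<bullet> (A *v x) \<le> (u \<bullet> (A *v u)) * (x \<bullet> x)"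
proof -
  have unit: "(1 / norm x) *\<^sub>R x \<in> S \<inter> sphere 0 1" if "x \<in> S" "x \<noteq> 0" for x
    using that scale by simp
  have "compact (S \<inter> sphere 0 1)"
    using assms(1) by (simp add: closed_Int_compact)
  moreover have "S \<inter> sphere 0 1 \<noteq> {}" using unit assms(2,3) by blast
  moreover have "continuous_on (S \<inter> sphere 0 1) (\<lambda>x. x \<bullet> (A *v x))"
    by (intro continuous_intros matrix_vector_mult_linear_continuous_on)
  ultimately have "\<exists>u\<in>S \<inter> sphere 0 1. \<forall>x\<in>S \<inter> sphere 0 1. x \<bullet> (A *v x) \<le> u \<bullet> (A *v u)"
    by (rule continuous_attains_sup)
  then obtain u where u: "u \<in> S \<inter> sphere 0 1"
    and max: "\<And>x. x \<in> S \<inter> sphere 0 1 \<Longrightarrow> x \<bullet> (A *v x) \<le> u \<bullet> (A *v u)"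
    by blast
  have "x \<bullet> (A *v x) \<le> (u \<bullet> (A *v u)) * (x \<bullet> x)" if x: "x \<in> S" for x
  proof (cases "x = 0")
    case False
    have "(1 / norm x) * ((1 / norm x) * (x \<bullet> (A *v x))) \<le> u \<bullet> (A *v u)"
      using max[OF unit[OF x False]] by (simp add: matrix_vector_mult_scaleR)
    then show ?thesis
      using False by (simp add: dot_square_norm power2_eq_square field_simps)
  qed simp
  with u that show ?thesis by auto
qed

text \<open>A maximizer of the Rayleigh quotient is an eigenvector, and its orthogonal complement within the
subspace is again invariant because of the symmetry.\<close>

lemma orthonormal_eigenbasis_of_invariant_subspace:
  fixes A :: "real^'n^'n"
  assumes sym: "transpose A = A" and "subspace S" "\<And>x. x \<in> S \<Longrightarrow> A *v x \<in> S"
  shows "\<exists>B\<subseteq>S. pairwise orthogonal B \<and> (\<forall>b\<in>B. norm b = 1 \<and> (\<exists>d. A *v b = d *\<^sub>R b)) \<and> span B = S"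
  using assms(2,3)
proof (induction "dim S" arbitrary: S rule: less_induct)
  case less
  note S = \<open>subspace S\<close> and inv = less.prems(2)
  show ?case
  proof (cases "S = {0}")
    case True
    then show ?thesis by (intro exI[of _ "{}"]) auto
  next
    case False
    obtain u where u: "u \<in> S" "norm u = 1"
      and max: "\<And>x. x \<in> S \<Longrightarrow> x \<bullet> (A *v x) \<le> (u \<bullet> (A *v u)) * (x \<bullet> x)"
    proof (rule quadratic_form_attains_max[of S A])
      show "closed S" using S by (rule closed_subspace)
      show "S \<noteq> {}" using subspace_0[OF S] by auto
      show "c *\<^sub>R x \<in> S" if "x \<in> S" for c x using S that by (rule subspace_scale)
    qed (use False in auto)
    have uu: "u \<bullet> u = 1" using u by (simp add: dot_square_norm)
    define M where "M = u \<bullet> (A *v u)"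
    have Au: "A *v u = M *\<^sub>R u"
      by (rule maximal_quotient_eigenvector[OF sym S inv]) (use max u uu M_def in auto)
    define T where "T = S \<inter> {x. u \<bullet> x = 0}"
    have T: "subspace T"
      unfolding T_def using S subspace_hyperplane by (intro subspace_inter)
    have Tinv: "A *v x \<in> T" if "x \<in> T" for x
      using that inv symmetric_dot[OF sym, of u x] by (auto simp: T_def Au inner_commute)
    have "u \<notin> T" using uu by (simp add: T_def)
    then have "T \<subset> S" using u unfolding T_def by blast
    then have "dim T < dim S"
      using dim_psubset[of T S] S T by (metis span_eq_iff)
    then have "\<exists>B\<subseteq>T. pairwise orthogonal B \<and>
        (\<forall>b\<in>B. norm b = 1 \<and> (\<exists>d. A *v b = d *\<^sub>R b)) \<and> span B = T"
      by (rule less.hyps) (rule T, rule Tinv)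
    then obtain B where B: "B \<subseteq> T" "pairwise orthogonal B"
      "\<forall>b\<in>B. norm b = 1 \<and> (\<exists>d. A *v b = d *\<^sub>R b)" "span B = T"
      by blast
    have "pairwise orthogonal (insert u B)"
      using B(1,2) by (auto simp: pairwise_insert T_def orthogonal_def inner_commute)
    moreover have "span (insert u B) = S"
    proof
      show "span (insert u B) \<subseteq> S"
        using B(1) u T_def S by (intro span_minimal) auto
      show "S \<subseteq> span (insert u B)"
      proof
        fix x assume x: "x \<in> S"
        have "x - (u \<bullet> x) *\<^sub>R u \<in> span B"
          unfolding B(4) T_def using x u uu S
          by (auto simp: subspace_diff subspace_scale inner_diff_right)
        then show "x \<in> span (insert u B)" using span_breakdown_eq by blast
      qed
    qed
    ultimately show ?thesis
      using B(1,3) u Au by (intro exI[of _ "insert u B"]) (auto simp: T_def)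
  qed
qed

theorem symmetric_matrix_diagonalization:
  fixes A :: "real^'n^'n"
  assumes "transpose A = A"
  obtains b :: "'n \<Rightarrow> real^'n" and d :: "'n \<Rightarrow> real"
  where "\<And>i j. b i \<bullet> b j = (if i = j then 1 else 0)"
    and "\<And>i. A *v b i = d i *\<^sub>R b i"
    and "\<And>x. x = (\<Sum>i\<in>UNIV. (x \<bullet> b i) *\<^sub>R b i)"
proof -
  obtain B where B: "pairwise orthogonal B"
    "\<forall>b\<in>B. norm b = 1 \<and> (\<exists>d. A *v b = d *\<^sub>R b)" "span B = UNIV"
    using orthonormal_eigenbasis_of_invariant_subspace[OF assms subspace_UNIV] by auto
  have "0 \<notin> B" using B(2) by force
  then have ind: "independent B" using B(1) pairwise_orthogonal_independent by blast
  then have fin: "finite B" by (rule independent_imp_finite)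
  have "card B = dim (UNIV :: (real^'n) set)"
    using basis_card_eq_dim[of B UNIV] ind B(3) by simp
  then have "card B = CARD('n)" by simp
  then obtain b where b: "bij_betw b (UNIV :: 'n set) B"
    using fin finite_same_card_bij[of "UNIV :: 'n set" B] by auto
  then have inB: "b i \<in> B" for i by (auto simp: bij_betw_def)
  then have "\<forall>i. \<exists>d. A *v b i = d *\<^sub>R b i"
    using B(2) by blast
  then obtain d where d: "\<And>i. A *v b i = d i *\<^sub>R b i"
    using choice[of "\<lambda>i d. A *v b i = d *\<^sub>R b i"] by blast
  have "b i \<bullet> b j = (if i = j then 1 else 0)" for i j
  proof (cases "i = j")
    case True
    then show ?thesis using B(2) inB[of j] by (simp add: dot_square_norm)
  next
    case False
    then have "b i \<noteq> b j" using b by (auto simp: bij_betw_def inj_on_def)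
    then show ?thesis using False B(1) inB by (auto simp: pairwise_def orthogonal_def)
  qed
  moreover have "x = (\<Sum>i\<in>UNIV. (x \<bullet> b i) *\<^sub>R b i)" for x
  proof -
    have "x = (\<Sum>v\<in>B. (x \<bullet> v) *\<^sub>R v)"
      by (rule orthonormal_basis_expand[symmetric]) (use B fin in auto)
    also have "\<dots> = (\<Sum>i\<in>UNIV. (x \<bullet> b i) *\<^sub>R b i)"
      by (rule sum.reindex_bij_betw[OF b, symmetric])
    finally show ?thesis .
  qed
  ultimately show ?thesis using d by (intro that)
qed

text \<open>The constant polynomial matrix \<open>P\<close> whose columns are the eigenvectors satisfies
\<open>(X I - A) P = P D\<close> with \<open>D\<close> diagonal, and its determinant is a unit since \<open>P\<close> is orthogonal. Hence
\<open>det (X I - A) = det D\<close>.\<close>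

lemma charpoly_of_eigenbasis:
  fixes A :: "real^'n^'n" and b :: "'n \<Rightarrow> real^'n"
  assumes on: "\<And>i j. b i \<bullet> b j = (if i = j then 1 else 0)"
    and eig: "\<And>i. A *v b i = d i *\<^sub>R b i"
  shows "charpoly A = (\<Prod>i\<in>UNIV. [:- d i, 1:])"
proof -
  define P P' where "P = (\<chi> i j. [:b j $ i:])" and "P' = (\<chi> i j. [:b i $ j:])"
  define X where "X = (\<chi> i j. (if i = j then [:0, 1:] else 0) - [:A $ i $ j:])"
  define D where "D = (\<chi> i j. if i = j then [:- d i, 1:] else 0)"
  have const: "(\<Sum>k\<in>UNIV. [:f k:]) = [:\<Sum>k\<in>UNIV. f k:]" for f :: "'n \<Rightarrow> real"
    by (induction rule: infinite_finite_induct[where A = UNIV]) auto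
  have AB: "(\<Sum>k\<in>UNIV. A $ i $ k * b j $ k) = d j * b j $ i" for i j
    using eig[of j] by (simp add: vec_eq_iff matrix_vector_mult_def)
  have "P' ** P = mat 1"
    using on by (auto simp: vec_eq_iff matrix_matrix_mult_def P_def P'_def const mat_def
        inner_vec_def one_pCons)
  then have "det P' * det P = 1" by (metis det_mul det_I)
  then have "det P \<noteq> 0" by auto
  have "X ** P = P ** D"
  proof -
    have "(\<Sum>k\<in>UNIV. X $ i $ k * P $ k $ j) = (\<Sum>k\<in>UNIV. P $ i $ k * D $ k $ j)" for i j
    proof -
      have "(\<Sum>k\<in>UNIV. X $ i $ k * P $ k $ j)
          = (\<Sum>k\<in>UNIV. (if i = k then [:0, 1:] * [:b j $ k:] else 0))
            - (\<Sum>k\<in>UNIV. [:A $ i $ k * b j $ k:])"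
        unfolding sum_subtractf[symmetric]
        by (rule sum.cong) (auto simp: X_def P_def algebra_simps)
      also have "\<dots> = [:0, 1:] * [:b j $ i:] - [:d j * b j $ i:]"
        by (simp add: const AB del: mult_pCons_left mult_pCons_right)
      also have "\<dots> = [:b j $ i:] * [:- d j, 1:]" by simp
      also have "\<dots> = (\<Sum>k\<in>UNIV. if k = j then [:b k $ i:] * [:- d k, 1:] else 0)"
        by simp
      also have "\<dots> = (\<Sum>k\<in>UNIV. P $ i $ k * D $ k $ j)"
        by (rule sum.cong) (auto simp: P_def D_def)
      finally show ?thesis .
    qed
    then show ?thesis by (simp add: vec_eq_iff matrix_matrix_mult_def)
  qed
  then have "det X * det P = det P * det D" by (metis det_mul)
  then have "det X = det D" using \<open>det P \<noteq> 0\<close> by simp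
  also have "\<dots> = (\<Prod>i\<in>UNIV. [:- d i, 1:])"
    by (subst det_diagonal) (auto simp: D_def)
  finally show ?thesis by (simp add: charpoly_def X_def)
qed

lemma order_prod_linear_factors:
  fixes d :: "'i \<Rightarrow> real"
  assumes "finite I"
  shows "order \<mu> (\<Prod>i\<in>I. [:- d i, 1:]) = card {i\<in>I. d i = \<mu>}"
  using assms
proof induction
  case (insert j I)
  have lin: "order \<mu> [:- d j, 1:] = (if d j = \<mu> then 1 else 0)"
    using order_power_n_n[of \<mu> 1] by (auto intro: order_0I)
  have "[:- d j, 1:] * (\<Prod>i\<in>I. [:- d i, 1:]) \<noteq> 0"
    using insert by (simp only: mult_eq_0_iff prod_zero_iff) simp
  then have "order \<mu> (\<Prod>i\<in>insert j I. [:- d i, 1:])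
      = (if d j = \<mu> then 1 else 0) + card {i\<in>I. d i = \<mu>}"
    using insert order_mult[of "[:- d j, 1:]" "\<Prod>i\<in>I. [:- d i, 1:]" \<mu>] lin by simp
  moreover have "{i\<in>insert j I. d i = \<mu>}
      = (if d j = \<mu> then insert j {i\<in>I. d i = \<mu>} else {i\<in>I. d i = \<mu>})" by auto
  ultimately show ?case using insert by simp
qed simp

lemma eigenbasis_alg_multiplicity:
  fixes A :: "real^'n^'n" and b :: "'n \<Rightarrow> real^'n"
  assumes "\<And>i j. b i \<bullet> b j = (if i = j then 1 else 0)"
    and "\<And>i. A *v b i = d i *\<^sub>R b i"
  shows "alg_multiplicity A \<mu> = card {i. d i = \<mu>}"
  using order_prod_linear_factors[of UNIV \<mu> d]
  by (simp add: alg_multiplicity_def charpoly_of_eigenbasis[OF assms])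

lemma eigenvector_real_iff:
  fixes A :: "real^'n^'n"
  shows "eigenvector A v \<mu> \<longleftrightarrow> v \<noteq> 0 \<and> A *v v = \<mu> *\<^sub>R v"
  by (simp add: eigenvector_def scalar_mult_eq_scaleR)

lemma eigenvectors_orthogonal:
  fixes A :: "real^'n^'n"
  assumes "transpose A = A" "A *v v = \<mu> *\<^sub>R v" "A *v w = \<nu> *\<^sub>R w" "\<mu> \<noteq> \<nu>"
  shows "v \<bullet> w = 0"
  using symmetric_dot[OF assms(1), of v w] assms by (simp add: inner_commute)

lemma eigenbasis_eigenvalue_iff:
  fixes A :: "real^'n^'n" and b :: "'n \<Rightarrow> real^'n"
  assumes sym: "transpose A = A"
    and on: "\<And>i j. b i \<bullet> b j = (if i = j then 1 else 0)"
    and eig: "\<And>i. A *v b i = d i *\<^sub>R b i"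
    and exp: "\<And>x. x = (\<Sum>i\<in>UNIV. (x \<bullet> b i) *\<^sub>R b i)"
  shows "eigenvalue A \<mu> \<longleftrightarrow> \<mu> \<in> range d"
proof
  assume "eigenvalue A \<mu>"
  then obtain u where u: "u \<noteq> 0" "A *v u = \<mu> *\<^sub>R u"
    by (auto simp: eigenvalue_def eigenvector_real_iff)
  show "\<mu> \<in> range d"
  proof (rule ccontr)
    assume "\<mu> \<notin> range d"
    then have "u \<bullet> b i = 0" for i
      using eigenvectors_orthogonal[OF sym u(2) eig] by auto
    then show False using exp[of u] u by simp
  qed
next
  have "b i \<noteq> 0" for i using on[of i i] by auto
  then show "eigenvalue A \<mu>" if "\<mu> \<in> range d"
    using that eig by (auto simp: eigenvalue_def eigenvector_real_iff)
qed

lemma finite_eigenvalues_symmetric: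
  fixes A :: "real^'n^'n"
  assumes sym: "transpose A = A"
  shows "finite {\<mu>. eigenvalue A \<mu>}"
proof -
  obtain b :: "'n \<Rightarrow> real^'n" and d :: "'n \<Rightarrow> real"
    where b: "\<And>i j. b i \<bullet> b j = (if i = j then 1 else 0)" "\<And>i. A *v b i = d i *\<^sub>R b i"
      "\<And>x. x = (\<Sum>i\<in>UNIV. (x \<bullet> b i) *\<^sub>R b i)"
    by (rule symmetric_matrix_diagonalization[OF sym]) blast
  have "{\<mu>. eigenvalue A \<mu>} = range d" using eigenbasis_eigenvalue_iff[OF sym b] by auto
  then show ?thesis by simp
qed

text \<open>For symmetric matrices the algebraic multiplicity counts the members of an orthonormal eigenbasis
that belong to the eigenvalue, and two such members cannot lie on a common line.\<close>

lemma simple_eigenvalue_of_eigenline: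
  fixes A :: "real^'n^'n"
  assumes sym: "transpose A = A" and u: "eigenvector A u \<mu>"
    and line: "\<And>v. eigenvector A v \<mu> \<Longrightarrow> \<exists>c. v = c *\<^sub>R u"
  shows "simple_eigenvalue A \<mu>"
proof -
  obtain b :: "'n \<Rightarrow> real^'n" and d :: "'n \<Rightarrow> real"
    where on: "\<And>i j. b i \<bullet> b j = (if i = j then 1 else 0)"
    and eig: "\<And>i. A *v b i = d i *\<^sub>R b i"
    and exp: "\<And>x. x = (\<Sum>i\<in>UNIV. (x \<bullet> b i) *\<^sub>R b i)"
    by (rule symmetric_matrix_diagonalization[OF sym]) blast
  have nz: "b i \<noteq> 0" for i using on[of i i] by auto
  have "eigenvalue A \<mu>" using u by (auto simp: eigenvalue_def)
  then have "\<mu> \<in> range d" using eigenbasis_eigenvalue_iff[OF sym on eig exp] by simp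
  then obtain i where i: "d i = \<mu>" by auto
  have unique: "j = i" if j: "d j = \<mu>" for j
  proof -
    obtain c c' where c: "b i = c *\<^sub>R u" "b j = c' *\<^sub>R u"
      using line[of "b i"] line[of "b j"] eig[of i] eig[of j] nz i j by (auto simp: eigenvector_real_iff)
    have "b i \<bullet> b j \<noteq> 0" using nz[of i] nz[of j] unfolding c by simp
    then show "j = i" using on[of i j] by (simp split: if_splits)
  qed
  have "{i. d i = \<mu>} = {i}" using i by (intro set_eqI iffI) (simp_all add: unique)
  then have "alg_multiplicity A \<mu> = 1"
    using eigenbasis_alg_multiplicity[of b A d, OF on eig] by simp
  then show ?thesis using u by (auto simp: simple_eigenvalue_def eigenvalue_def)
qed

text \<open>The witness \<open>p\<close> is the member of an orthonormal eigenbasis that belongs to the positive eigenvalue: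
on its orthogonal complement the form is a combination of squares with nonpositive coefficients.\<close>

lemma exactly_one_positive_eigenvalue_hyperplane:
  fixes Q :: "real^'n^'n"
  assumes sym: "transpose Q = Q" and one: "exactly_one_positive_eigenvalue Q"
  obtains p where "\<And>x. x \<bullet> p = 0 \<Longrightarrow> x \<bullet> (Q *v x) \<le> 0"
proof -
  obtain b :: "'n \<Rightarrow> real^'n" and d :: "'n \<Rightarrow> real"
    where on: "\<And>i j. b i \<bullet> b j = (if i = j then 1 else 0)"
    and eig: "\<And>i. Q *v b i = d i *\<^sub>R b i"
    and exp: "\<And>x. x = (\<Sum>i\<in>UNIV. (x \<bullet> b i) *\<^sub>R b i)"
    by (rule symmetric_matrix_diagonalization[OF sym]) blast
  have pos: "{\<mu>. 0 < \<mu> \<and> eigenvalue Q \<mu>} = d ` {i. 0 < d i}" 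
    using eigenbasis_eigenvalue_iff[OF sym on eig exp] by auto
  \<comment> \<open>Summing the multiplicities counts each index \<open>i\<close> with \<open>0 < d i\<close> once, in the fibre over \<open>d i\<close>.\<close>
  have "card {i. 0 < d i} = (\<Sum>\<mu>\<in>d ` {i. 0 < d i}. card {i \<in> {i. 0 < d i}. d i = \<mu>})"
    using sum.image_gen[of "{i. 0 < d i}" "\<lambda>_. 1 :: nat" d] by simp
  also have "\<dots> = (\<Sum>\<mu>\<in>d ` {i. 0 < d i}. alg_multiplicity Q \<mu>)"
    unfolding eigenbasis_alg_multiplicity[of b Q d, OF on eig]
    by (intro sum.cong arg_cong[where f = card]) auto
  also have "\<dots> = 1"
    using one unfolding exactly_one_positive_eigenvalue_def pos .
  finally obtain k where k: "{i. 0 < d i} = {k}" using card_1_singletonE by metis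
  have "x \<bullet> (Q *v x) \<le> 0" if x: "x \<bullet> b k = 0" for x
  proof -
    have "x \<bullet> (Q *v x) = (\<Sum>i\<in>UNIV. d i * (x \<bullet> b i)\<^sup>2)"
    proof -
      have "x \<bullet> (Q *v x) = x \<bullet> (Q *v (\<Sum>i\<in>UNIV. (x \<bullet> b i) *\<^sub>R b i))"
        using exp[of x] by simp
      also have "\<dots> = x \<bullet> (\<Sum>i\<in>UNIV. Q *v ((x \<bullet> b i) *\<^sub>R b i))"
        by (subst linear_sum[OF matrix_vector_mul_linear]) simp
      also have "\<dots> = (\<Sum>i\<in>UNIV. d i * (x \<bullet> b i)\<^sup>2)"
        by (auto simp: matrix_vector_mult_scaleR eig inner_sum_right power2_eq_square intro!: sum.cong)
      finally show ?thesis .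
    qed
    also have "\<dots> \<le> 0"
    proof (rule sum_nonpos)
      fix i
      show "d i * (x \<bullet> b i)\<^sup>2 \<le> 0"
      proof (cases "i = k")
        case False
        then have "d i \<le> 0" using k by force
        then show ?thesis by (simp add: mult_nonpos_nonneg)
      qed (use x in simp)
    qed
    finally show ?thesis .
  qed
  then show ?thesis by (rule that)
qed

text \<open>Subtracting a multiple of \<open>e\<close> brings \<open>x\<close> into the hyperplane on which the form is nonpositive; the
resulting quadratic inequality in the factor \<open>s\<close> gives the claim by completing the square. Unlike
the number of positive eigenvalues, this inequality is preserved under limits.\<close>

lemma reverse_cauchy_schwarz:
  fixes Q :: "real^'n^'n"
  assumes sym: "transpose Q = Q" and one: "exactly_one_positive_eigenvalue Q"
    and e: "0 < e \<bullet> (Q *v e)"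
  shows "(e \<bullet> (Q *v e)) * (x \<bullet> (Q *v x)) \<le> (e \<bullet> (Q *v x))\<^sup>2"
proof -
  obtain p where p: "\<And>x. x \<bullet> p = 0 \<Longrightarrow> x \<bullet> (Q *v x) \<le> 0"
    using exactly_one_positive_eigenvalue_hyperplane[OF sym one] by metis
  then have "e \<bullet> p \<noteq> 0" using e by force
  define s where "s = (x \<bullet> p) / (e \<bullet> p)"
  define \<alpha> \<beta> \<gamma> where "\<alpha> = e \<bullet> (Q *v e)" and "\<beta> = e \<bullet> (Q *v x)" and "\<gamma> = x \<bullet> (Q *v x)"
  have "(x - s *\<^sub>R e) \<bullet> p = 0" using \<open>e \<bullet> p \<noteq> 0\<close> by (simp add: s_def inner_diff_left)
  then have "(x - s *\<^sub>R e) \<bullet> (Q *v (x - s *\<^sub>R e)) \<le> 0" by (rule p)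
  also have "(x - s *\<^sub>R e) \<bullet> (Q *v (x - s *\<^sub>R e)) = \<gamma> - 2 * s * \<beta> + s\<^sup>2 * \<alpha>"
    using symmetric_dot[OF sym, of x e]
    by (simp add: matrix_vector_mult_diff_distrib matrix_vector_mult_scaleR inner_diff_left
        inner_diff_right power2_eq_square \<alpha>_def \<beta>_def \<gamma>_def algebra_simps)
  finally have "\<alpha> * (\<gamma> - 2 * s * \<beta> + s\<^sup>2 * \<alpha>) \<le> 0"
    using e by (simp add: \<alpha>_def mult_nonneg_nonpos)
  moreover have "0 \<le> (\<beta> - s * \<alpha>)\<^sup>2" by simp
  ultimately have "\<alpha> * \<gamma> \<le> \<beta>\<^sup>2" by (simp add: power2_eq_square algebra_simps)
  then show ?thesis by (simp add: \<alpha>_def \<beta>_def \<gamma>_def)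
qed

text \<open>For an eigenvector \<open>v = x + i y\<close>, comparing \<open>x \<bullet> (A *v y)\<close> with \<open>y \<bullet> (A *v x)\<close> gives
\<open>Im \<mu> * (\<bar>x\<bar>\<^sup>2 + \<bar>y\<bar>\<^sup>2) = 0\<close>, and one of \<open>x\<close> and \<open>y\<close> is a real eigenvector.\<close>

lemma complex_eigenvalue_symmetric:
  fixes A :: "real^'n^'n"
  assumes sym: "transpose A = A"
    and ev: "eigenvalue (\<chi> i j. complex_of_real (A $ i $ j)) \<mu>"
  shows "Im \<mu> = 0 \<and> eigenvalue A (Re \<mu>)"
proof -
  obtain v where v: "v \<noteq> 0" and eq: "(\<chi> i j. complex_of_real (A $ i $ j)) *v v = \<mu> *s v"
    using ev by (auto simp: eigenvalue_def eigenvector_def)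
  define x y where "x = (\<chi> i. Re (v $ i))" and "y = (\<chi> i. Im (v $ i))"
  have comp: "(\<Sum>j\<in>UNIV. complex_of_real (A $ i $ j) * v $ j) = \<mu> * v $ i" for i
    using eq by (simp add: vec_eq_iff matrix_vector_mult_def)
  have Ax: "A *v x = Re \<mu> *\<^sub>R x - Im \<mu> *\<^sub>R y"
    using comp[THEN arg_cong[of _ _ Re]]
    by (simp add: vec_eq_iff matrix_vector_mult_def x_def y_def)
  have Ay: "A *v y = Im \<mu> *\<^sub>R x + Re \<mu> *\<^sub>R y"
    using comp[THEN arg_cong[of _ _ Im]]
    by (simp add: vec_eq_iff matrix_vector_mult_def x_def y_def add.commute)
  have xy: "x \<noteq> 0 \<or> y \<noteq> 0"
    using v by (auto simp: vec_eq_iff x_def y_def complex_eq_iff)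
  have "Im \<mu> * (x \<bullet> x + y \<bullet> y) = 0"
    using symmetric_dot[OF sym, of x y]
    by (simp add: Ax Ay inner_diff_right inner_add_right inner_commute algebra_simps)
  moreover have "0 < x \<bullet> x + y \<bullet> y"
    using xy by (metis add_nonneg_pos add_pos_nonneg inner_ge_zero inner_gt_zero_iff)
  ultimately have "Im \<mu> = 0" by simp
  then show ?thesis
    using xy Ax Ay by (auto simp: eigenvalue_def eigenvector_real_iff)
qed

text \<open>The definition takes a maximum over complex eigenvalues. By the previous lemma the moduli are those
of the finitely many real eigenvalues, which the bound on the form controls; finiteness is what
makes the maximum meaningful.\<close>

lemma spectral_radius_symmetric:
  fixes A :: "real^'n^'n"
  assumes sym: "transpose A = A" and u: "eigenvector A u M"
    and bound: "\<And>x. \<bar>x \<bullet> (A *v x)\<bar> \<le> M * (x \<bullet> x)"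
  shows "spectral_radius A = M"
proof -
  let ?C = "\<chi> i j. complex_of_real (A $ i $ j)"
  let ?E = "{cmod \<mu> |\<mu>. eigenvalue ?C \<mu>}"
  have real: "\<exists>\<nu>. eigenvalue A \<nu> \<and> cmod \<mu> = \<bar>\<nu>\<bar>" if "eigenvalue ?C \<mu>" for \<mu>
    using complex_eigenvalue_symmetric[OF sym that] by (auto simp: cmod_eq_Re)
  have le: "\<bar>\<nu>\<bar> \<le> M" if ev: "eigenvalue A \<nu>" for \<nu>
  proof -
    obtain v where v: "v \<noteq> 0" "A *v v = \<nu> *\<^sub>R v"
      using ev by (auto simp: eigenvalue_def eigenvector_real_iff)
    then have "\<bar>\<nu>\<bar> * (v \<bullet> v) \<le> M * (v \<bullet> v)" using bound[of v] by (simp add: abs_mult)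
    then show ?thesis using v by simp
  qed
  have "?E \<subseteq> abs ` {\<nu>. eigenvalue A \<nu>}" using real by fastforce
  then have "finite ?E"
    using finite_eigenvalues_symmetric[OF sym] finite_surj by blast
  moreover have "r \<le> M" if "r \<in> ?E" for r using that real le by fastforce
  moreover have "M \<in> ?E"
  proof -
    define v where "v = (\<chi> i. complex_of_real (u $ i))"
    have "v \<noteq> 0" using u by (auto simp: v_def vec_eq_iff eigenvector_def)
    moreover have "(\<Sum>j\<in>UNIV. A $ i $ j * u $ j) = M * u $ i" for i
      using u by (auto simp: eigenvector_def vec_eq_iff matrix_vector_mult_def)
    then have "?C *v v = complex_of_real M *s v"
      by (simp add: vec_eq_iff matrix_vector_mult_def v_def flip: of_real_mult of_real_sum)
    ultimately have "eigenvalue ?C (complex_of_real M)"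
      by (auto simp: eigenvalue_def eigenvector_def)
    moreover have "0 \<le> M" using le[of M] u by (auto simp: eigenvalue_def)
    ultimately show ?thesis by (intro CollectI exI[of _ "complex_of_real M"]) auto
  qed
  ultimately show ?thesis unfolding spectral_radius_def by (intro Max_eqI)
qed

section \<open>Self-dual cones\<close>

lemma self_dual_cone_mem_iff:
  assumes "self_dual_cone K"
  shows "y \<in> K \<longleftrightarrow> (\<forall>x\<in>K. 0 \<le> y \<bullet> x)"
proof -
  have "K = dual_cone K" using assms unfolding self_dual_cone_def by (rule conjunct2)
  from arg_cong[OF this, of "\<lambda>S. y \<in> S"] show ?thesis
    unfolding dual_cone_def mem_Collect_eq .
qed

lemma self_dual_coneI:
  assumes "self_dual_cone K" and "\<And>x. x \<in> K \<Longrightarrow> 0 \<le> y \<bullet> x"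
  shows "y \<in> K"
  using assms(2) by (intro iffD2[OF self_dual_cone_mem_iff[OF assms(1)]] ballI)

lemma self_dual_cone_dot_nonneg:
  assumes "self_dual_cone K" "x \<in> K" "y \<in> K"
  shows "0 \<le> x \<bullet> y"
  using iffD1[OF self_dual_cone_mem_iff[OF assms(1)] assms(2)] assms(3) by (rule bspec)

lemma self_dual_cone_closed_convex:
  assumes K: "self_dual_cone K"
  shows "closed K" "convex K" "0 \<in> K"
    and "x \<in> K \<Longrightarrow> y \<in> K \<Longrightarrow> x + y \<in> K"
    and "x \<in> K \<Longrightarrow> 0 \<le> c \<Longrightarrow> c *\<^sub>R x \<in> K"
proof -
  note pos = self_dual_cone_dot_nonneg[OF K]
  have "K = (\<Inter>x\<in>K. {y. x \<bullet> y \<ge> 0})"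
  proof
    show "K \<subseteq> (\<Inter>x\<in>K. {y. x \<bullet> y \<ge> 0})" using pos by blast
    show "(\<Inter>x\<in>K. {y. x \<bullet> y \<ge> 0}) \<subseteq> K"
      by (rule subsetI, rule self_dual_coneI[OF K]) (simp add: inner_commute)
  qed
  moreover have "closed (\<Inter>x\<in>K. {y. x \<bullet> y \<ge> 0})"
    by (intro closed_INT ballI closed_halfspace_ge)
  moreover have "convex (\<Inter>x\<in>K. {y. x \<bullet> y \<ge> 0})"
    by (intro convex_INT convex_halfspace_ge)
  ultimately show "closed K" "convex K" by simp_all
  show "0 \<in> K" by (rule self_dual_coneI[OF K]) simp
  show "x \<in> K \<Longrightarrow> y \<in> K \<Longrightarrow> x + y \<in> K"
    by (rule self_dual_coneI[OF K]) (simp add: pos inner_add_left)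
  show "x \<in> K \<Longrightarrow> 0 \<le> c \<Longrightarrow> c *\<^sub>R x \<in> K"
    by (rule self_dual_coneI[OF K]) (simp add: pos)
qed

text \<open>If the interior were empty, the convex set \<open>K\<close> would lie in a hyperplane, which contains the origin.
A normal vector of it is orthogonal to \<open>K\<close> and thus belongs to the dual cone, that is to \<open>K\<close>, so it is
orthogonal to itself.\<close>

lemma self_dual_cone_interior_dense:
  assumes K: "self_dual_cone K"
  shows "closure (interior K) = K"
proof -
  have "interior K \<noteq> {}"
  proof
    assume "interior K = {}"
    then obtain a b where a: "a \<noteq> 0" "K \<subseteq> {x. a \<bullet> x = b}"
      using empty_interior_subset_hyperplane self_dual_cone_closed_convex(2)[OF K] by metis
    then have "b = 0" using self_dual_cone_closed_convex(3)[OF K] by auto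
    then have "a \<in> K" 
      by (intro self_dual_coneI[OF K]) (use a in auto)
    then show False using a \<open>b = 0\<close> by auto
  qed
  then show ?thesis
    using convex_closure_interior self_dual_cone_closed_convex(1,2)[OF K] closure_closed by metis
qed

text \<open>The normal \<open>a\<close> of a supporting hyperplane at a boundary point \<open>u\<close> is nonnegative on \<open>K\<close>, because
\<open>u + w\<close> stays in \<open>K\<close>, and hence is an element of \<open>K\<close> itself. As it is nonpositive at \<open>u\<close>, this
contradicts the strict positivity of \<open>u\<close>.\<close>

lemma self_dual_cone_strictly_positive_interior:
  assumes K: "self_dual_cone K" and u: "u \<in> K"
    and pos: "\<And>w. w \<in> K \<Longrightarrow> w \<noteq> 0 \<Longrightarrow> 0 < u \<bullet> w"
  shows "u \<in> interior K"
proof (rule ccontr)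
  note cl = self_dual_cone_closed_convex[OF K]
  assume "u \<notin> interior K"
  moreover have "interior K \<noteq> {}"
    using self_dual_cone_interior_dense[OF K] cl(3) by auto
  ultimately have "u \<notin> rel_interior K" by (simp add: rel_interior_nonempty_interior)
  moreover have clK: "closure K = K" using cl(1) by (rule closure_closed)
  ultimately obtain a where "a \<noteq> 0" and "\<And>y. y \<in> closure K \<Longrightarrow> a \<bullet> u \<le> a \<bullet> y"
    using supporting_hyperplane_relative_frontier[OF cl(2), of u] u by metis
  then have a: "a \<noteq> 0" "\<And>y. y \<in> K \<Longrightarrow> a \<bullet> u \<le> a \<bullet> y" by (simp_all add: clK)
  have "0 \<le> a \<bullet> w" if "w \<in> K" for w
    using a(2)[OF cl(4)[OF u that]] by (simp add: inner_add_right)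
  then have "a \<in> K" by (rule self_dual_coneI[OF K]) simp
  moreover have "a \<bullet> u \<le> 0" using a(2)[OF cl(3)] by simp
  ultimately show False using pos[of a] a(1) by (simp add: inner_commute)
qed

text \<open>This is Moreau's decomposition: \<open>p\<close> is the point of \<open>K\<close> closest to \<open>x\<close>, and the variational inequality
for the closest point says that \<open>p - x\<close> is in the dual cone and orthogonal to \<open>p\<close>.\<close>

lemma self_dual_cone_decomposition:
  assumes K: "self_dual_cone K"
  obtains p q where "p \<in> K" "q \<in> K" "x = p - q" "p \<bullet> q = 0"
proof -
  note cl = self_dual_cone_closed_convex[OF K]
  define p where "p = closest_point K x"
  have p: "p \<in> K" using cl(1,3) closest_point_in_set p_def by blast
  have dot: "(x - p) \<bullet> (y - p) \<le> 0" if "y \<in> K" for y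
    using closest_point_dot[OF cl(2,1) that] by (simp add: p_def)
  have "0 \<le> (p - x) \<bullet> w" if "w \<in> K" for w
    using dot[of "p + w"] cl(4)[OF p that] by (simp add: inner_diff_left)
  then have "p - x \<in> K" by (rule self_dual_coneI[OF K]) simp
  moreover have "(x - p) \<bullet> p = 0"
    using dot[of 0] dot[of "2 *\<^sub>R p"] cl(3) cl(5)[OF p, of 2] by (simp add: scaleR_2)
  then have "p \<bullet> (p - x) = 0" by (simp add: inner_diff_left inner_diff_right inner_commute)
  ultimately show ?thesis using that[of p "p - x"] p by simp
qed

section \<open>The Perron--Frobenius property\<close>

text \<open>Write \<open>x = p - q\<close> by Moreau's decomposition. Then \<open>p + q\<close> is in \<open>K\<close> and has the same norm as \<open>x\<close>, while
\<open>p \<bullet> (A *v q) \<ge> 0\<close> shows that the form is at least as large at \<open>p + q\<close> as its absolute value at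
\<open>x\<close>. So the maximum of the form over the unit vectors of \<open>K\<close> is already the maximum of its
absolute value over all unit vectors.\<close>

lemma cone_preserving_symmetric_top_eigenvector:
  fixes A :: "real^'n^'n"
  assumes K: "self_dual_cone K" and sym: "transpose A = A"
    and pres: "\<And>x. x \<in> K \<Longrightarrow> A *v x \<in> K"
  obtains u M where "u \<in> K" "u \<noteq> 0" "A *v u = M *\<^sub>R u"
    "\<And>x. \<bar>x \<bullet> (A *v x)\<bar> \<le> M * (x \<bullet> x)"
proof -
  note cl = self_dual_cone_closed_convex[OF K]
  \<comment> \<open>Nonzero vectors exist, and they would all lie in the dual of \<open>{0}\<close>.\<close>
  have "K \<noteq> {0}"
  proof
    assume eq: "K = {0}"
    then have "axis undefined 1 \<in> K"
      by (intro self_dual_coneI[OF K]) (simp add: eq)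
    then show False using eq by (simp add: axis_eq_0_iff)
  qed
  then obtain u where u: "u \<in> K" "norm u = 1"
    and max: "\<And>x. x \<in> K \<Longrightarrow> x \<bullet> (A *v x) \<le> (u \<bullet> (A *v u)) * (x \<bullet> x)"
    using quadratic_form_attains_max[OF cl(1), of A] cl(3,5) by (metis empty_iff)
  define M where "M = u \<bullet> (A *v u)"
  have bound: "\<bar>x \<bullet> (A *v x)\<bar> \<le> M * (x \<bullet> x)" for x
  proof -
    obtain p q where pq: "p \<in> K" "q \<in> K" "x = p - q" "p \<bullet> q = 0"
      by (rule self_dual_cone_decomposition[OF K, of x]) blast
    have nn: "0 \<le> v \<bullet> (A *v w)" if "v \<in> K" "w \<in> K" for v w
      by (intro self_dual_cone_dot_nonneg[OF K] that pres)
    have s: "q \<bullet> (A *v p) = p \<bullet> (A *v q)" using symmetric_dot[OF sym] by metis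
    have minus: "x \<bullet> (A *v x) = p \<bullet> (A *v p) + q \<bullet> (A *v q) - 2 * (p \<bullet> (A *v q))"
      by (simp add: pq(3) matrix_vector_mult_diff_distrib inner_diff_left inner_diff_right s)
    have plus: "(p + q) \<bullet> (A *v (p + q)) = p \<bullet> (A *v p) + q \<bullet> (A *v q) + 2 * (p \<bullet> (A *v q))"
      by (simp add: matrix_vector_right_distrib inner_add_left inner_add_right s)
    have "(p + q) \<bullet> (p + q) = x \<bullet> x"
      using pq(4) by (simp add: pq(3) inner_add_left inner_add_right inner_diff_left
          inner_diff_right inner_commute)
    then have "(p + q) \<bullet> (A *v (p + q)) \<le> M * (x \<bullet> x)"
      using max[OF cl(4)[OF pq(1,2)]] by (simp add: M_def)
    then show ?thesis
      using minus plus nn[OF pq(1) pq(2)] nn[OF pq(1) pq(1)] nn[OF pq(2) pq(2)] by linarith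
  qed
  have "A *v u = M *\<^sub>R u"
  proof (rule maximal_quotient_eigenvector[OF sym subspace_UNIV])
    show "x \<bullet> (A *v x) \<le> M * (x \<bullet> x)" for x using bound[of x] by linarith
    show "u \<bullet> (A *v u) = M * (u \<bullet> u)" using u(2) by (simp add: M_def dot_square_norm)
  qed auto
  moreover have "u \<noteq> 0" using u(2) by auto
  ultimately show ?thesis using that[of u M] u(1) bound by blast
qed

text \<open>Applied to \<open>e = u\<close>, the top eigenvector in \<open>K\<close>, the reverse Cauchy--Schwarz inequality makes the form
nonpositive on the orthogonal complement of \<open>u\<close>, and negative there away from \<open>0\<close> since \<open>A\<close> is
nonsingular. On \<open>K\<close> the form is nonnegative, so no nonzero vector of \<open>K\<close> is orthogonal to \<open>u\<close>. This
places \<open>u\<close> in the interior. The remaining claims follow because other eigenvectors and the range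
of \<open>\<rho> I - A\<close> are orthogonal to \<open>u\<close>.\<close>

theorem lorentzian_matrix_perron_frobenius:
  fixes A :: "real^'n^'n"
  assumes K: "self_dual_cone K" and sym: "transpose A = A" and inv: "invertible A"
    and pres: "\<And>x. x \<in> K \<Longrightarrow> A *v x \<in> K"
    and rcs: "\<And>e x. e \<in> K \<Longrightarrow> (e \<bullet> (A *v e)) * (x \<bullet> (A *v x)) \<le> (e \<bullet> (A *v x))\<^sup>2"
    and \<rho>: "\<rho> = spectral_radius A"
  shows "0 < \<rho> \<and> simple_eigenvalue A \<rho> \<and>
    (\<exists>u. u \<in> interior K \<and> eigenvector A u \<rho> \<and>
         (\<forall>v. eigenvector A v \<rho> \<longrightarrow> (\<exists>c. v = c *\<^sub>R u)) \<and>
         (\<forall>v \<mu>. v \<in> K - {0} \<and> eigenvector A v \<mu> \<longrightarrow> (\<exists>c>0. v = c *\<^sub>R u))) \<and>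
    K \<inter> range (\<lambda>x. (\<rho> *\<^sub>R mat 1 - A) *v x) = {0}"
proof -
  obtain u M where u: "u \<in> K" "u \<noteq> 0" and AuM: "A *v u = M *\<^sub>R u"
    and bound: "\<And>x. \<bar>x \<bullet> (A *v x)\<bar> \<le> M * (x \<bullet> x)"
    using cone_preserving_symmetric_top_eigenvector[OF K sym pres] by blast
  have "eigenvector A u M" using u AuM by (simp add: eigenvector_real_iff)
  then have "M = \<rho>" using spectral_radius_symmetric[OF sym _ bound] \<rho> by simp
  with AuM have Au: "A *v u = \<rho> *\<^sub>R u" by simp
  have uev: "eigenvector A u \<rho>" using u Au by (simp add: eigenvector_real_iff)
  have inj: "x = 0" if "A *v x = 0" for x
    using inv that unfolding invertible_left_inverse matrix_left_invertible_ker by blast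
  have uu: "0 < u \<bullet> u" using u by simp
  have "\<bar>\<rho>\<bar> * (u \<bullet> u) \<le> \<rho> * (u \<bullet> u)"
    using bound[of u] \<open>M = \<rho>\<close> by (simp add: Au abs_mult)
  then have "0 \<le> \<rho>" using uu by simp
  moreover have "\<rho> \<noteq> 0" using inj[of u] u Au by auto
  ultimately have pos: "0 < \<rho>" by simp
  have perp: "u \<bullet> (A *v x) = \<rho> * (u \<bullet> x)" for x
    using symmetric_dot[OF sym, of u x] by (simp add: Au inner_commute)
  have nonpos: "x \<bullet> (A *v x) \<le> 0" if "u \<bullet> x = 0" for x
  proof -
    have "(\<rho> * (u \<bullet> u)) * (x \<bullet> (A *v x)) \<le> 0"
      using rcs[OF u(1), of x] that by (simp add: perp)
    moreover have "0 < \<rho> * (u \<bullet> u)" using pos uu by simp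
    ultimately show ?thesis using mult_pos_pos[of "\<rho> * (u \<bullet> u)" "x \<bullet> (A *v x)"] by linarith
  qed
  have neg: "x \<bullet> (A *v x) < 0" if x: "u \<bullet> x = 0" "x \<noteq> 0" for x
  proof (rule ccontr)
    assume "\<not> x \<bullet> (A *v x) < 0"
    then have "x \<bullet> (A *v x) = 0" using nonpos[OF x(1)] by simp
    moreover have m: "(- A) *v y = - (A *v y)" for y
      by (simp add: vec_eq_iff matrix_vector_mult_def sum_negf)
    ultimately have "(- A) *v x = 0"
    proof (intro psd_form_isotropic_in_kernel[where S = "{x. u \<bullet> x = 0}"])
      show "transpose (- A) = - A" using sym by (simp add: vec_eq_iff transpose_def)
      show "subspace {x. u \<bullet> x = 0}" by (rule subspace_hyperplane)
    qed (use m nonpos x in \<open>auto simp: perp\<close>)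
    then show False using inj[of x] x m by simp
  qed
  have upos: "0 < u \<bullet> w" if w: "w \<in> K" "w \<noteq> 0" for w
  proof -
    have "0 \<le> u \<bullet> w" by (rule self_dual_cone_dot_nonneg[OF K u(1) w(1)])
    moreover have "u \<bullet> w \<noteq> 0"
      using neg[of w] w(2) self_dual_cone_dot_nonneg[OF K w(1) pres[OF w(1)]] by linarith
    ultimately show ?thesis by simp
  qed
  have uint: "u \<in> interior K"
    by (rule self_dual_cone_strictly_positive_interior[OF K u(1) upos])
  have line: "\<exists>c. v = c *\<^sub>R u" if v: "eigenvector A v \<rho>" for v
  proof -
    define c where "c = (u \<bullet> v) / (u \<bullet> u)"
    define x where "x = v - c *\<^sub>R u"
    have "u \<bullet> x = 0" using uu by (simp add: x_def c_def inner_diff_right)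
    moreover have "A *v x = \<rho> *\<^sub>R x"
      using v Au by (simp add: x_def eigenvector_real_iff matrix_vector_mult_diff_distrib
          matrix_vector_mult_scaleR scaleR_diff_right)
    moreover have "0 \<le> \<rho> * (x \<bullet> x)" using pos by simp
    ultimately have "x = 0" using neg[of x] by fastforce
    then show ?thesis by (auto simp: x_def)
  qed
  have Kline: "\<exists>c>0. v = c *\<^sub>R u" if v: "v \<in> K - {0}" "eigenvector A v \<mu>" for v \<mu>
  proof -
    have uv: "0 < u \<bullet> v" using upos v by auto
    have "\<mu> = \<rho>"
      using eigenvectors_orthogonal[OF sym Au, of v \<mu>] uv v(2) by (auto simp: eigenvector_real_iff)
    then obtain c where c: "v = c *\<^sub>R u" using line v by blast
    then have "0 < c" using uv uu by (simp add: zero_less_mult_iff)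
    then show ?thesis using c by blast
  qed
  have range0: "K \<inter> range (\<lambda>x. (\<rho> *\<^sub>R mat 1 - A) *v x) = {0}"
  proof -
    have B: "(\<rho> *\<^sub>R mat 1 - A) *v x = \<rho> *\<^sub>R x - A *v x" for x
      by (simp add: matrix_vector_mult_diff_rdistrib flip: scaleR_matrix_vector_assoc)
    have "u \<bullet> ((\<rho> *\<^sub>R mat 1 - A) *v x) = 0" for x
      by (simp add: B inner_diff_right perp)
    then have "y = 0" if "y \<in> K" "y \<in> range (\<lambda>x. (\<rho> *\<^sub>R mat 1 - A) *v x)" for y
      using upos[of y] that by fastforce
    moreover have "0 \<in> range (\<lambda>x. (\<rho> *\<^sub>R mat 1 - A) *v x)"
      by (rule range_eqI[of _ _ 0]) simp
    ultimately show ?thesis using self_dual_cone_closed_convex(3)[OF K] by blast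
  qed
  show ?thesis
    using pos simple_eigenvalue_of_eigenline[OF sym uev line] uint uev line Kline range0 by blast
qed

section \<open>Hessians of Lorentzian forms\<close>

lemma hessian_lorentzian_interior:
  assumes L: "K_Lorentzian K d f" and d: "2 \<le> d" and a: "a \<in> interior K"
  shows "x \<in> interior K \<Longrightarrow> y \<in> interior K \<Longrightarrow> 0 < y \<bullet> (hessian f a *v x)"
    and "e \<in> interior K \<Longrightarrow> (e \<bullet> (hessian f a *v e)) * (z \<bullet> (hessian f a *v z))
           \<le> (e \<bullet> (hessian f a *v z))\<^sup>2"
proof -
  have form: "form_of_degree d f" using L by (simp add: K_Lorentzian_def)
  have "length (replicate (d - 2) a) = d - 2 \<and> set (replicate (d - 2) a) \<subseteq> interior K"
    using a by auto
  moreover have "\<not> d \<le> 1" using d by simp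
  ultimately have "\<exists>Q. transpose Q = Q \<and>
      (\<forall>x. foldr dir_deriv (replicate (d - 2) a) f x = x \<bullet> (Q *v x)) \<and>
      exactly_one_positive_eigenvalue Q \<and>
      (\<forall>x\<in>interior K. \<forall>y\<in>interior K. 0 < y \<bullet> (Q *v x))"
    using L unfolding K_Lorentzian_def by (simp only: if_False)
  then obtain Q where sym: "transpose Q = Q"
    and Q: "\<And>x. foldr dir_deriv (replicate (d - 2) a) f x = x \<bullet> (Q *v x)"
    and one: "exactly_one_positive_eigenvalue Q"
    and Qpos: "\<And>x y. x \<in> interior K \<Longrightarrow> y \<in> interior K \<Longrightarrow> 0 < y \<bullet> (Q *v x)"
    by blast
  define c where "c = 2 / (fact (d - 2) :: real)"
  have c: "0 < c" by (simp add: c_def)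
  have H: "hessian f a *v x = c *\<^sub>R (Q *v x)" for x
    unfolding hessian_eq_polarized_quadratic_form[OF form d sym Q] c_def
    by (simp add: scaleR_matrix_vector_assoc)
  show "x \<in> interior K \<Longrightarrow> y \<in> interior K \<Longrightarrow> 0 < y \<bullet> (hessian f a *v x)"
    using c Qpos by (simp add: H)
  assume e: "e \<in> interior K"
  show "(e \<bullet> (hessian f a *v e)) * (z \<bullet> (hessian f a *v z)) \<le> (e \<bullet> (hessian f a *v z))\<^sup>2"
    using mult_left_mono[OF reverse_cauchy_schwarz[OF sym one Qpos[OF e e], of z], of "c\<^sup>2"]
    by (simp add: H power2_eq_square algebra_simps)
qed

text \<open>At boundary points of \<open>K\<close> the definition of a Lorentzian form gives no direct information. The two
inequalities valid in the interior depend continuously on the base point \<open>a\<close> and on the vectors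
involved, so they extend to \<open>K\<close>, one variable at a time.\<close>

lemma hessian_lorentzian_cone:
  assumes K: "self_dual_cone K" and L: "K_Lorentzian K d f" and d: "2 \<le> d" and a: "a \<in> K"
  shows "x \<in> K \<Longrightarrow> hessian f a *v x \<in> K"
    and "e \<in> K \<Longrightarrow> (e \<bullet> (hessian f a *v e)) * (z \<bullet> (hessian f a *v z))
           \<le> (e \<bullet> (hessian f a *v z))\<^sup>2"
proof -
  note dense = self_dual_cone_interior_dense[OF K]
  have poly: "real_polynomial_function f"
    using L form_polynomial by (auto simp: K_Lorentzian_def)
  note cont_a = continuous_on_hessian_bilinear[OF poly]
  have cont: "continuous_on S (\<lambda>x. hessian f a *v x)" for S
    by (rule matrix_vector_mult_linear_continuous_on)
  have extend: "0 \<le> g y" if "continuous_on K g" "\<And>x. x \<in> interior K \<Longrightarrow> 0 \<le> g x" "y \<in> K"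
    for g :: "_ \<Rightarrow> real" and y
    using continuous_ge_on_closure[of "interior K" g y 0] that dense by simp
  have "0 \<le> y \<bullet> (hessian f a *v x)" if "x \<in> interior K" "y \<in> interior K" for x y
    using extend[OF cont_a[of K y x] _ a] hessian_lorentzian_interior(1)[OF L d] that
    by (simp add: less_imp_le)
  then have "0 \<le> y \<bullet> (hessian f a *v x)" if "x \<in> K" "y \<in> interior K" for x y
    using extend[of "\<lambda>x. y \<bullet> (hessian f a *v x)"] that
    by (simp add: continuous_on_inner cont)
  then have "0 \<le> (hessian f a *v x) \<bullet> y" if "x \<in> K" "y \<in> K" for x y
    using extend[of "\<lambda>y. (hessian f a *v x) \<bullet> y"] that
    by (simp add: continuous_on_inner inner_commute)
  then show "x \<in> K \<Longrightarrow> hessian f a *v x \<in> K"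
    by (rule self_dual_coneI[OF K]) simp
  let ?g = "\<lambda>e a. (e \<bullet> (hessian f a *v z))\<^sup>2 - (e \<bullet> (hessian f a *v e)) * (z \<bullet> (hessian f a *v z))"
  have "0 \<le> ?g e a" if "e \<in> interior K" for e
    by (rule extend[OF _ _ a])
       (use hessian_lorentzian_interior(2)[OF L d] that in
         \<open>auto intro!: continuous_intros cont_a\<close>)
  then have "0 \<le> ?g e a" if "e \<in> K" for e
    by (rule extend[rotated, OF _ that]) (auto intro!: continuous_intros cont)
  then show "e \<in> K \<Longrightarrow> (e \<bullet> (hessian f a *v e)) * (z \<bullet> (hessian f a *v z))
           \<le> (e \<bullet> (hessian f a *v z))\<^sup>2" by simp
qed

theorem corollary3p8:
  fixes K :: "(real^'n) set" and f :: "real^'n \<Rightarrow> real" and d :: nat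
    and a :: "real^'n" and A :: "real^'n^'n" and \<rho> :: real
  assumes "self_dual_cone K"
    and "K_Lorentzian K d f"
    and "a \<in> K"
    and "A = hessian f a"
    and "invertible A"
    and "\<rho> = spectral_radius A"
  shows "0 < \<rho> \<and> simple_eigenvalue A \<rho> \<and>
    (\<exists>u. u \<in> interior K \<and> eigenvector A u \<rho> \<and>
         (\<forall>v. eigenvector A v \<rho> \<longrightarrow> (\<exists>c. v = c *\<^sub>R u)) \<and>
         (\<forall>v \<mu>. v \<in> K - {0} \<and> eigenvector A v \<mu> \<longrightarrow> (\<exists>c>0. v = c *\<^sub>R u))) \<and>
    K \<inter> range (\<lambda>x. (\<rho> *\<^sub>R mat 1 - A) *v x) = {0}"
proof -
  have form: "form_of_degree d f" using assms(2) by (simp add: K_Lorentzian_def)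
  have d: "2 \<le> d"
  proof (rule ccontr)
    assume "\<not> 2 \<le> d"
    then have "A = 0" using hessian_degree_le_1[OF form] assms(4) by simp
    moreover have "\<forall>x. A *v x = 0 \<longrightarrow> x = 0"
      using assms(5) unfolding invertible_left_inverse matrix_left_invertible_ker .
    ultimately have "axis undefined 1 = (0 :: real^'n)" by simp
    then show False by (simp add: axis_eq_0_iff)
  qed
  show ?thesis
  proof (rule lorentzian_matrix_perron_frobenius[OF assms(1) _ assms(5) _ _ assms(6)])
    show "transpose A = A"
      using hessian_symmetric form_polynomial[OF form] assms(4) by simp
  qed (use hessian_lorentzian_cone[OF assms(1,2) d assms(3)] assms(4) in auto)
qed

end
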